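(* Let $S$ be a skip graph with alphabet $\{0,1\}$. Fix nodes $t$ and $u$ with $u < t$, and let $d = |\{v : u < v \le t\}|$. Then for any integer $\ell \ge 0$, $\Pr[L_{tu} > 2^{-\ell}] \le 2e^{-2^{-\ell} d}$.
   Context: Skip graph: a finite set of nodes with distinct keys from a totally ordered set; each node $x$ has a membership vector $m(x)\in\{0,1\}^\omega$ whose bits are independent and uniformly random. For each finite binary word $w$, $S_w$ is the list of nodes whose membership vector has prefix $w$, sorted by key; $w\upharpoonright i$ is the length-$i$ prefix of $w$. Search from $s$ to $t$ (with $s<t$): the search keeps a current node $v$ (initially $s$) and a current level $\ell$ (initially the least level at which $s$ is alone in $S_{m(s)\upharpoonright\ell}$); repeatedly, if the successor of $v$ in $S_{m(s)\upharpoonright\ell}$ exists and has key $\le t$, it moves to that successor; otherwise if $\ell>0$ it decreases $\ell$ by one, and if $\ell=0$ it stops. The average congestion $L_{tu}$ imposed by searches for $t$ on $u$ is the probability that a search from $s$ to $t$ (for a node $s<u$) passes through $u$, conditioned on the membership vectors of all nodes in the key interval $[u,t]$, with $m(s)$ uniformly random; it is a random variable determined by the membership vectors of the nodes in $[u,t]$ (and does not depend on the choice of $s$). The outer probability is over the membership vectors of the nodes in $[u,t]$. *)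

theory Defs
  imports "HOL-Probability.Probability"
begin

text \<open>
  A node is identified with its key, so a skip graph is given by a finite set \<open>V\<close> of keys and a
  family \<open>m\<close> of membership vectors.
\<close>

definition skip_list :: "'a::linorder set \<Rightarrow> ('a \<Rightarrow> bool stream) \<Rightarrow> bool list \<Rightarrow> 'a list" where
  "skip_list V m w = sorted_list_of_set {x \<in> V. stake (length w) (m x) = w}"

definition successor_in :: "'a list \<Rightarrow> 'a \<Rightarrow> 'a \<Rightarrow> bool" where
  "successor_in xs x y \<longleftrightarrow> (\<exists>i. Suc i < length xs \<and> xs ! i = x \<and> xs ! Suc i = y)"

definition alone_at :: "'a::linorder set \<Rightarrow> ('a \<Rightarrow> bool stream) \<Rightarrow> 'a \<Rightarrow> nat \<Rightarrow> bool" where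
  "alone_at V m s l \<longleftrightarrow> skip_list V m (stake l (m s)) = [s]"

text \<open>
  \<open>search_state V m s t v l\<close>: the search from \<open>s\<close> to \<open>t\<close> at some moment has current node \<open>v\<close> and
  current level \<open>l\<close>. If \<open>s\<close> is alone on no level (an event of probability zero), there is no search.
\<close>

inductive search_state ::
  "'a::linorder set \<Rightarrow> ('a \<Rightarrow> bool stream) \<Rightarrow> 'a \<Rightarrow> 'a \<Rightarrow> 'a \<Rightarrow> nat \<Rightarrow> bool"
  for V m s t where
  start: "alone_at V m s l \<Longrightarrow> (\<And>k. k < l \<Longrightarrow> \<not> alone_at V m s k) \<Longrightarrow> search_state V m s t s l"
| forward: "search_state V m s t v l \<Longrightarrow> successor_in (skip_list V m (stake l (m s))) v y \<Longrightarrow> y \<le> t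
    \<Longrightarrow> search_state V m s t y l"
| down: "search_state V m s t v (Suc l)
    \<Longrightarrow> \<not> (\<exists>y. successor_in (skip_list V m (stake (Suc l) (m s))) v y \<and> y \<le> t)
    \<Longrightarrow> search_state V m s t v l"

definition passes_through ::
  "'a::linorder set \<Rightarrow> ('a \<Rightarrow> bool stream) \<Rightarrow> 'a \<Rightarrow> 'a \<Rightarrow> 'a \<Rightarrow> bool" where
  "passes_through V m s t u \<longleftrightarrow> (\<exists>l. search_state V m s t u l)"

definition random_bits :: "bool stream measure" where
  "random_bits = stream_space (measure_pmf (pmf_of_set UNIV))"

definition skip_graph_space :: "'a set \<Rightarrow> ('a \<Rightarrow> bool stream) measure" where
  "skip_graph_space V = (\<Pi>\<^sub>M x\<in>V. random_bits)"

text \<open>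
  The sub-\<open>\<sigma>\<close>-algebra generated by the membership vectors of the nodes in the set \<open>I\<close>.
\<close>

definition vectors_algebra :: "'a set \<Rightarrow> 'a set \<Rightarrow> ('a \<Rightarrow> bool stream) measure" where
  "vectors_algebra V I =
     vimage_algebra (space (skip_graph_space V)) (\<lambda>m. restrict m I) (\<Pi>\<^sub>M x\<in>I. random_bits)"

text \<open>
  The average congestion on \<open>u\<close> of searches for \<open>t\<close>, measured with source \<open>s\<close>: the conditional
  probability that the search passes through \<open>u\<close>, i.e. the conditional expectation of the
  indicator. It is a random variable on the whole space that is measurable with respect to the
  membership vectors of the nodes in \<open>[u, t]\<close>, and is unique up to null sets.
\<close>

definition avg_congestion ::
  "'a::linorder set \<Rightarrow> 'a \<Rightarrow> 'a \<Rightarrow> 'a \<Rightarrow> ('a \<Rightarrow> bool stream) \<Rightarrow> real" where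
  "avg_congestion V s t u =
     real_cond_exp (skip_graph_space V) (vectors_algebra V {x \<in> V. u \<le> x \<and> x \<le> t})
       (indicator {m \<in> space (skip_graph_space V). passes_through V m s t u})"

end

theory Submission imports Defs begin

text \<open>
  Let \<open>W\<close> be the set of nodes in \<open>(u, t]\<close>. When the search leaves level \<open>k + 1\<close>, its current node is
  the last one up to \<open>t\<close> in the list of level \<open>k + 1\<close>. So if it visits \<open>u\<close> at level \<open>k\<close>, then
  \<open>m(u)\<close> agrees with \<open>m(s)\<close> on the first \<open>k\<close> bits, while no node of \<open>W\<close> agrees with \<open>m(s)\<close> on the
  first \<open>k + 1\<close> bits. Call \<open>i\<close> uncovered if no node of \<open>W\<close> has as a prefix the first \<open>i\<close> bits of
  \<open>m(u)\<close> followed by the opposite of its next bit. If no \<open>i < l\<close> is uncovered, then the search can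
  pass through \<open>u\<close> only if \<open>m(s)\<close> and \<open>m(u)\<close> have a common prefix of length \<open>l\<close>, which has
  conditional probability \<open>2\<^sup>-\<^sup>l\<close>. An index \<open>i\<close> is uncovered with probability \<open>(1 - 2\<^sup>-\<^sup>i\<^sup>-\<^sup>1)\<^sup>d\<close>, and a
  union bound over \<open>i < l\<close> gives \<open>\<Sum>i<l. exp (-d / 2\<^sup>i\<^sup>+\<^sup>1)\<close>. Each term is the square of the next one, so if
  the last term is at most \<open>1/2\<close>, the sum is at most twice the last term; otherwise the claimed
  bound exceeds \<open>1\<close>.
\<close>

section \<open>Prefixes of bit streams\<close>

declare stake.simps(2) [simp del]

text \<open>In the binary trie of finite words, this is the sibling of the ancestor of
  \<open>x\<close> at depth \<open>i + 1\<close>. It marks the streams that branch off from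
  \<open>x\<close> exactly at bit \<open>i\<close>.\<close>

definition sibling_prefix :: "nat \<Rightarrow> bool stream \<Rightarrow> bool list" where
  "sibling_prefix i x = stake i x @ [\<not> x !! i]"

lemma stake_eq_mono: "stake n x = stake n y \<Longrightarrow> k \<le> n \<Longrightarrow> stake k x = stake k y"
  by (metis min.absorb1 take_stake)

lemma stake_eq_iff: "stake n x = stake n y \<longleftrightarrow> (\<forall>i<n. x !! i = y !! i)"
  by (induction n) (auto simp: stake_Suc less_Suc_eq)

text \<open>Take the first index of disagreement. As the alphabet has two letters, the bit of
  \<open>x\<close> there must be the negated bit of \<open>y\<close>.\<close>

lemma stake_differs_sibling:
  assumes "stake l x \<noteq> stake l y"
  obtains i where "i < l" "stake (Suc i) x = sibling_prefix i y"
proof -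
  define i where "i = (LEAST i. x !! i \<noteq> y !! i)"
  obtain j where j: "j < l" "x !! j \<noteq> y !! j"
    using assms by (auto simp: stake_eq_iff)
  have "x !! i \<noteq> y !! i"
    unfolding i_def by (rule LeastI) (rule j)
  moreover have "i \<le> j"
    unfolding i_def by (rule Least_le) (rule j)
  moreover have "stake i x = stake i y"
    unfolding stake_eq_iff using not_less_Least by (auto simp: i_def)
  ultimately show ?thesis
    using j by (intro that[of i]) (auto simp: sibling_prefix_def stake_Suc)
qed

subsection \<open>Search paths\<close>

lemma set_skip_list:
  "finite V \<Longrightarrow> set (skip_list V m (stake k x)) = {v \<in> V. stake k (m v) = stake k x}"
  by (simp add: skip_list_def)

lemma successor_in_sorted_list_of_setD:
  assumes "finite A" and "successor_in (sorted_list_of_set A) x y"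
  shows "y \<in> A" "x < y"
proof -
  obtain i where i: "Suc i < card A" "sorted_list_of_set A ! i = x" "sorted_list_of_set A ! Suc i = y"
    using assms by (auto simp: successor_in_def)
  show "y \<in> A"
    using i assms(1) nth_mem[of "Suc i" "sorted_list_of_set A"] by simp
  show "x < y"
    using i sorted_wrt_nth_less[OF strict_sorted_list_of_set[of A], of i "Suc i"] by simp
qed

lemma successor_in_sorted_list_of_setI:
  assumes "finite A" "x \<in> A" "z \<in> A" "x < z"
  obtains y where "successor_in (sorted_list_of_set A) x y" "y \<le> z"
proof -
  let ?xs = "sorted_list_of_set A"
  obtain i j where i: "i < length ?xs" "?xs ! i = x" and j: "j < length ?xs" "?xs ! j = z"
    using assms by (metis in_set_conv_nth set_sorted_list_of_set)
  have "i < j"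
  proof (rule ccontr)
    assume "\<not> i < j"
    then have "?xs ! j \<le> ?xs ! i"
      using i by (intro sorted_nth_mono) auto
    with i j assms show False by simp
  qed
  with i j have "successor_in ?xs x (?xs ! Suc i)"
    by (auto simp: successor_in_def intro!: exI[of _ i])
  moreover have "?xs ! Suc i \<le> z"
    using \<open>i < j\<close> j by (metis Suc_leI sorted_nth_mono sorted_sorted_list_of_set)
  ultimately show ?thesis by (rule that)
qed

text \<open>The last conjunct concerns level \<open>k + 1\<close>, not \<open>k\<close>, because a
  downward step from level \<open>k + 1\<close> happens only when no node up to \<open>t\<close>
  remains ahead there. At the start it holds because \<open>s\<close> is alone on level
  \<open>l\<close> and hence also on level \<open>l + 1\<close>. A forward step only shrinks the
  range of \<open>x\<close>.\<close>

lemma search_state_invariant: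
  assumes "finite V" and "search_state V m s t v k"
  shows "v \<in> V \<and> stake k (m v) = stake k (m s) \<and>
    (\<forall>x\<in>V. v < x \<and> x \<le> t \<longrightarrow> stake (Suc k) (m x) \<noteq> stake (Suc k) (m s))"
  using assms(2)
proof induction
  case (start l)
  then have "set (skip_list V m (stake l (m s))) = {s}"
    by (simp add: alone_at_def)
  then have *: "{v \<in> V. stake l (m v) = stake l (m s)} = {s}"
    using assms(1) by (simp add: set_skip_list)
  have "x = s" if "x \<in> V" "stake (Suc l) (m x) = stake (Suc l) (m s)" for x
    using * that stake_eq_mono[OF that(2), of l] by auto
  with * show ?case by blast
next
  case (forward v l y)
  have "successor_in (sorted_list_of_set {x \<in> V. stake l (m x) = stake l (m s)}) v y"
    using forward by (simp add: skip_list_def)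
  from successor_in_sorted_list_of_setD[OF _ this] assms(1)
  show ?case using forward.IH by auto
next
  case (down v l)
  have False if x: "x \<in> V" "v < x" "x \<le> t" "stake (Suc l) (m x) = stake (Suc l) (m s)" for x
  proof -
    let ?A = "{x \<in> V. stake (Suc l) (m x) = stake (Suc l) (m s)}"
    obtain y where "successor_in (sorted_list_of_set ?A) v y" "y \<le> x"
      by (rule successor_in_sorted_list_of_setI[of ?A v x]) (use x down.IH assms(1) in auto)
    then show False
      using down.hyps x by (auto simp: skip_list_def)
  qed
  then show ?case
    using down.IH stake_eq_mono[of "Suc l" "m v" "m s" l] by auto
qed

lemma passes_through_common_prefix:
  assumes "finite V" and "passes_through V m s t u"
    and cover: "\<And>i. i < l \<Longrightarrow> \<exists>v\<in>V. u < v \<and> v \<le> t \<and> stake (Suc i) (m v) = sibling_prefix i (m u)"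
  shows "stake l (m s) = stake l (m u)"
proof (rule ccontr)
  assume "stake l (m s) \<noteq> stake l (m u)"
  then obtain i where i: "i < l" "stake (Suc i) (m s) = sibling_prefix i (m u)"
    by (rule stake_differs_sibling)
  obtain k where k: "stake k (m u) = stake k (m s)"
    "\<And>x. x \<in> V \<Longrightarrow> u < x \<Longrightarrow> x \<le> t \<Longrightarrow> stake (Suc k) (m x) \<noteq> stake (Suc k) (m s)"
    using assms(1,2) search_state_invariant unfolding passes_through_def by blast
  obtain v where v: "v \<in> V" "u < v" "v \<le> t" "stake (Suc i) (m v) = stake (Suc i) (m s)"
    using cover[OF i(1)] i(2) by auto
  \<comment> \<open>If \<open>k \<le> i\<close>, then \<open>v\<close> would be a node in
    \<open>(u, t]\<close> that shares \<open>k + 1\<close> bits with \<open>s\<close>, which the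
    invariant rules out. So bit \<open>i\<close>, where \<open>m s\<close> and \<open>m u\<close>
    differ, lies inside their common prefix of length \<open>k\<close>.\<close>
  have "i < k"
    using stake_eq_mono[OF v(4), of "Suc k"] k(2)[OF v(1-3)] by (meson Suc_le_mono not_less)
  then have "(\<not> m u !! i) = m s !! i" "m u !! i = m s !! i"
    using i(2) k(1) by (auto simp: stake_eq_iff sibling_prefix_def stake_Suc)
  then show False by simp
qed

subsection \<open>Random membership vectors\<close>

lemma prob_space_random_bits: "prob_space random_bits"
  unfolding random_bits_def
  by (intro prob_space.prob_space_stream_space measure_pmf.prob_space_axioms)

lemma space_random_bits [simp]: "space random_bits = UNIV"
  by (simp add: random_bits_def space_stream_space)

lemma sets_random_bits [measurable_cong]:
  "sets random_bits = sets (stream_space (count_space UNIV))"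
  unfolding random_bits_def by (rule sets_stream_space_cong) simp

lemma measurable_stake_random_bits [measurable]:
  "stake n \<in> random_bits \<rightarrow>\<^sub>M count_space UNIV"
  unfolding measurable_cong_sets[OF sets_random_bits refl] by (rule measurable_stake)

lemma measurable_snth_random_bits [measurable]:
  "(\<lambda>x. x !! n) \<in> random_bits \<rightarrow>\<^sub>M count_space UNIV"
  unfolding measurable_cong_sets[OF sets_random_bits refl] by (rule measurable_snth)

lemma measurable_sibling_prefix [measurable]:
  "sibling_prefix n \<in> random_bits \<rightarrow>\<^sub>M count_space UNIV"
  unfolding sibling_prefix_def by measurable

lemma prefix_in_sets_random_bits: "{x. stake n x = w} \<in> sets random_bits"
proof -
  have "{x \<in> space random_bits. stake n x = w} \<in> sets random_bits" by measurable
  then show ?thesis by simp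
qed

lemma measure_random_bits_prefix:
  "measure random_bits {x. stake (length w) x = w} = 1 / 2 ^ length w"
proof (induction w)
  case Nil
  then show ?case
    using prob_space.prob_space[OF prob_space_random_bits] by simp
next
  case (Cons b w)
  let ?p = "pmf_of_set (UNIV :: bool set)"
  interpret R: prob_space random_bits by (rule prob_space_random_bits)
  \<comment> \<open>The law of a random stream splits into the first bit \<open>c\<close> and an
    independent tail. The event on the tail is the prefix event of \<open>w\<close> if
    \<open>c = b\<close>, and empty otherwise.\<close>
  have "emeasure random_bits {x. stake (Suc (length w)) x = b # w}
      = (\<integral>\<^sup>+c. emeasure random_bits {x \<in> space random_bits. c ## x \<in> {x. stake (Suc (length w)) x = b # w}} \<partial>?p)"
    using prob_space.emeasure_stream_space[OF measure_pmf.prob_space_axioms, of "{x. stake (Suc (length w)) x = b # w}" ?p]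
      prefix_in_sets_random_bits[of "Suc (length w)" "b # w"] by (simp add: random_bits_def)
  also have "\<dots> = (\<integral>\<^sup>+c. ennreal (1 / 2 ^ length w) * indicator {b} c \<partial>?p)"
    by (intro nn_integral_cong) (auto simp: R.emeasure_eq_measure Cons.IH stake.simps(2) split: split_indicator)
  also have "\<dots> = ennreal (1 / 2 ^ length w) * ennreal (1 / 2)"
    by (subst nn_integral_cmult_indicator)
       (auto simp: emeasure_pmf_single)
  also have "\<dots> = ennreal (1 / 2 ^ length (b # w))"
    by (subst ennreal_mult[symmetric]) auto
  finally show ?case
    by (simp add: R.emeasure_eq_measure)
qed

section \<open>The product space, the algebra of the vectors in \<open>I\<close>, and
  independence\<close>

lemma product_prob_space_random_bits: "product_prob_space (\<lambda>_. random_bits)"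
  by (simp add: product_prob_spaceI prob_space_random_bits)

lemma prob_space_skip_graph_space: "prob_space (skip_graph_space V)"
  unfolding skip_graph_space_def by (rule prob_space_PiM) (rule prob_space_random_bits)

lemma measure_skip_graph_space_PiE:
  assumes "finite V" "\<And>v. v \<in> V \<Longrightarrow> A v \<in> sets random_bits"
  shows "measure (skip_graph_space V) (Pi\<^sub>E V A) = (\<Prod>v\<in>V. measure random_bits (A v))"
proof -
  interpret product_prob_space "\<lambda>_. random_bits" V
    by (rule product_prob_space_random_bits)
  interpret finite_product_prob_space "\<lambda>_. random_bits" V
    by unfold_locales (rule assms)
  show ?thesis
    unfolding skip_graph_space_def using assms(2) by (rule finite_measure_PiM_emb)
qed

lemma measurable_vector:
  "v \<in> V \<Longrightarrow> (\<lambda>m. m v) \<in> skip_graph_space V \<rightarrow>\<^sub>M random_bits"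
  unfolding skip_graph_space_def by (rule measurable_component_singleton)

lemma sets_vectors_algebra:
  assumes "I \<subseteq> V"
  shows "sets (vectors_algebra V I) =
    {(\<lambda>m. restrict m I) -` A \<inter> space (skip_graph_space V) | A. A \<in> sets (\<Pi>\<^sub>M x\<in>I. random_bits)}"
  unfolding vectors_algebra_def
  by (rule sets_vimage_algebra2) (use assms in \<open>auto simp: skip_graph_space_def space_PiM\<close>)

lemma subalgebra_vectors_algebra:
  assumes "I \<subseteq> V"
  shows "subalgebra (skip_graph_space V) (vectors_algebra V I)"
  unfolding subalgebra_def sets_vectors_algebra[OF assms]
  using measurable_restrict_subset[OF assms, of "\<lambda>_. random_bits"]
  by (auto simp: vectors_algebra_def skip_graph_space_def intro: measurable_sets)

lemma measurable_vectors_algebra: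
  assumes "v \<in> I" "I \<subseteq> V"
  shows "(\<lambda>m. m v) \<in> vectors_algebra V I \<rightarrow>\<^sub>M random_bits"
proof -
  have "(\<lambda>m. restrict m I) \<in> vectors_algebra V I \<rightarrow>\<^sub>M (\<Pi>\<^sub>M x\<in>I. random_bits)"
    unfolding vectors_algebra_def
    by (rule measurable_vimage_algebra1) (use assms in \<open>auto simp: skip_graph_space_def space_PiM\<close>)
  from measurable_compose[OF this measurable_component_singleton[OF assms(1)]]
  show ?thesis using assms by simp
qed

text \<open>Independence means that the joint law of the coordinates is the product of the marginal
  laws. The joint law is that of the identity map, hence the product measure itself, and every
  marginal is \<open>random_bits\<close>.\<close>

lemma indep_vars_skip_graph_space:
  assumes "finite V" "V \<noteq> {}"
  shows "prob_space.indep_vars (skip_graph_space V) (\<lambda>_. random_bits) (\<lambda>v m. m v) V"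
proof -
  interpret P: prob_space "skip_graph_space V" by (rule prob_space_skip_graph_space)
  have "distr (skip_graph_space V) (\<Pi>\<^sub>M v\<in>V. random_bits) (\<lambda>m. restrict m V) =
      distr (skip_graph_space V) (skip_graph_space V) (\<lambda>m. m)"
    by (intro distr_cong) (auto simp: skip_graph_space_def space_PiM)
  also have "\<dots> = skip_graph_space V" by (rule distr_id)
  also have "\<dots> = (\<Pi>\<^sub>M v\<in>V. distr (skip_graph_space V) random_bits (\<lambda>m. m v))"
    unfolding skip_graph_space_def
    by (intro PiM_cong refl product_prob_space.PiM_component[OF product_prob_space_random_bits, symmetric])
  finally show ?thesis
    using assms by (subst P.indep_vars_iff_distr_eq_PiM') (auto intro: measurable_vector)
qed

text \<open>\<open>A\<close> is a preimage under restriction to \<open>I\<close>, and the event on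
  \<open>m s\<close> is one under restriction to \<open>{s}\<close>. Restrictions of an independent
  family to disjoint index sets are independent.\<close>

lemma prob_vectors_algebra_indep:
  assumes "finite V" "I \<subseteq> V" "s \<in> V - I"
    and A: "A \<in> sets (vectors_algebra V I)" and B: "B \<in> sets random_bits"
  shows "measure (skip_graph_space V) (A \<inter> {m. m s \<in> B}) =
    measure (skip_graph_space V) A * measure random_bits B"
proof -
  let ?M = "skip_graph_space V"
  let ?B = "{f \<in> space (\<Pi>\<^sub>M v\<in>{s}. random_bits). f s \<in> B}"
  interpret P: prob_space ?M by (rule prob_space_skip_graph_space)
  obtain A' where A': "A' \<in> sets (\<Pi>\<^sub>M v\<in>I. random_bits)" "A = (\<lambda>m. restrict m I) -` A' \<inter> space ?M"
    using A assms(2) by (auto simp: sets_vectors_algebra)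
  have "?B \<in> sets (\<Pi>\<^sub>M v\<in>{s}. random_bits)"
    by (rule sets_Collect_single') (use B in auto)
  then have "P.prob ((\<lambda>m. (restrict m I, restrict m {s})) -` (A' \<times> ?B) \<inter> space ?M)
      = P.prob ((\<lambda>m. restrict m I) -` A' \<inter> space ?M) * P.prob ((\<lambda>m. restrict m {s}) -` ?B \<inter> space ?M)"
    using assms A'(1)
    by (intro P.indep_varD[OF P.indep_var_restrict[OF indep_vars_skip_graph_space]]) auto
  moreover have "(\<lambda>m. (restrict m I, restrict m {s})) -` (A' \<times> ?B) \<inter> space ?M = A \<inter> {m. m s \<in> B}"
    by (auto simp: A'(2) space_PiM)
  moreover have "(\<lambda>m. restrict m {s}) -` ?B \<inter> space ?M = {m \<in> space ?M. m s \<in> B}"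
    by (auto simp: space_PiM)
  moreover have "P.prob {m \<in> space ?M. m s \<in> B} = measure random_bits B"
    using product_prob_space.emeasure_PiM_Collect_single[OF product_prob_space_random_bits, of s V B] assms B
    by (simp add: skip_graph_space_def measure_def)
  ultimately show ?thesis using A'(2) by simp
qed

section \<open>Common prefixes conditioned on the vectors in \<open>I\<close>\<close>

lemma common_prefix_in_sets:
  assumes "u \<in> V" "s \<in> V"
  shows "{m \<in> space (skip_graph_space V). stake l (m s) = stake l (m u)} \<in> sets (skip_graph_space V)"
proof -
  have [measurable]: "(\<lambda>m. m u) \<in> skip_graph_space V \<rightarrow>\<^sub>M random_bits"
    "(\<lambda>m. m s) \<in> skip_graph_space V \<rightarrow>\<^sub>M random_bits"
    using assms by (auto intro: measurable_vector)
  show ?thesis by measurable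
qed

text \<open>The target prefix is itself random, so independence does not apply directly. Splitting
  \<open>A\<close> by the value \<open>w\<close> of the prefix of \<open>m u\<close> keeps each
  piece in the algebra of \<open>I\<close> and makes the target fixed; each piece then contributes
  the factor \<open>1 / 2 ^ l\<close>.\<close>

lemma prob_common_prefix:
  assumes "finite V" "I \<subseteq> V" "s \<in> V - I" "u \<in> I" and A: "A \<in> sets (vectors_algebra V I)"
  shows "measure (skip_graph_space V) (A \<inter> {m. stake l (m s) = stake l (m u)}) =
    measure (skip_graph_space V) A / 2 ^ l"
proof -
  let ?M = "skip_graph_space V" and ?F = "vectors_algebra V I"
  interpret P: prob_space ?M by (rule prob_space_skip_graph_space)
  define W where "W = {w :: bool list. length w = l}"
  define D where "D w = A \<inter> {m. stake l (m u) = w}" for w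
  have "finite W"
    unfolding W_def using finite_lists_length_eq[of "UNIV :: bool set" l] by simp
  have [measurable]: "(\<lambda>m. m u) \<in> ?F \<rightarrow>\<^sub>M random_bits"
    using assms by (intro measurable_vectors_algebra)
  have sub: "sets ?F \<subseteq> sets ?M" "space ?F = space ?M"
    using subalgebra_vectors_algebra[OF assms(2)] by (auto simp: subalgebra_def)
  have DF: "D w \<in> sets ?F" for w
  proof -
    have "{m \<in> space ?F. stake l (m u) = w} \<in> sets ?F" by measurable
    with A have "A \<inter> {m \<in> space ?F. stake l (m u) = w} \<in> sets ?F" by (rule sets.Int)
    also have "A \<inter> {m \<in> space ?F. stake l (m u) = w} = D w"
      using sets.sets_into_space[OF A] by (auto simp: D_def)
    finally show ?thesis .
  qed
  have DsM: "D w \<inter> {m. m s \<in> {x. stake l x = w}} \<in> sets ?M" for w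
  proof -
    have [measurable]: "(\<lambda>m. m s) \<in> ?M \<rightarrow>\<^sub>M random_bits"
      using assms(3) by (intro measurable_vector) auto
    have "{m \<in> space ?M. stake l (m s) = w} \<in> sets ?M" by measurable
    then have "D w \<inter> {m \<in> space ?M. stake l (m s) = w} \<in> sets ?M"
      using DF[of w] sub(1) by (intro sets.Int) auto
    also have "D w \<inter> {m \<in> space ?M. stake l (m s) = w} = D w \<inter> {m. m s \<in> {x. stake l x = w}}"
      using sets.sets_into_space[OF DF[of w]] sub by auto
    finally show ?thesis .
  qed
  have "A \<inter> {m. stake l (m s) = stake l (m u)} = (\<Union>w\<in>W. D w \<inter> {m. m s \<in> {x. stake l x = w}})"
    by (auto simp: W_def D_def)
  also have "P.prob \<dots> = (\<Sum>w\<in>W. P.prob (D w \<inter> {m. m s \<in> {x. stake l x = w}}))"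
    using DsM \<open>finite W\<close>
    by (intro P.finite_measure_finite_Union) (auto simp: disjoint_family_on_def D_def)
  also have "\<dots> = (\<Sum>w\<in>W. P.prob (D w) * (1 / 2 ^ l))"
    using assms DF measure_random_bits_prefix prefix_in_sets_random_bits
    by (intro sum.cong refl) (subst prob_vectors_algebra_indep, auto simp: W_def)
  also have "\<dots> = P.prob (\<Union>w\<in>W. D w) / 2 ^ l"
    using DF sub \<open>finite W\<close>
    by (subst P.finite_measure_finite_Union)
       (auto simp: disjoint_family_on_def D_def sum_divide_distrib)
  also have "(\<Union>w\<in>W. D w) = A"
    by (auto simp: W_def D_def)
  finally show ?thesis .
qed

text \<open>Since \<open>prob_common_prefix\<close> holds for every \<open>A\<close> in the algebra,
  the constant \<open>1 / 2 ^ l\<close> has the integrals that characterize the conditional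
  expectation.\<close>

lemma cond_exp_common_prefix:
  assumes "finite V" "I \<subseteq> V" "s \<in> V - I" "u \<in> I"
  shows "AE m in skip_graph_space V. real_cond_exp (skip_graph_space V) (vectors_algebra V I)
    (indicator {m \<in> space (skip_graph_space V). stake l (m s) = stake l (m u)}) m = 1 / 2 ^ l"
proof -
  let ?M = "skip_graph_space V" and ?F = "vectors_algebra V I"
  let ?E = "{m \<in> space ?M. stake l (m s) = stake l (m u)}"
  interpret P: prob_space ?M by (rule prob_space_skip_graph_space)
  interpret finite_measure_subalgebra ?M ?F
    using subalgebra_vectors_algebra[OF assms(2)] by unfold_locales
  have E: "?E \<in> sets ?M"
    using assms by (intro common_prefix_in_sets) auto
  show ?thesis
  proof (rule real_cond_exp_charact)
    fix A assume A: "A \<in> sets ?F"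
    then have AM: "A \<in> sets ?M"
      using subalg by (auto simp: subalgebra_def)
    have "A \<inter> ?E = A \<inter> {m. stake l (m s) = stake l (m u)}"
      using sets.sets_into_space[OF AM] by auto
    then have "P.prob (A \<inter> ?E) = P.prob A / 2 ^ l"
      using prob_common_prefix[OF assms A, of l] by simp
    moreover have "(\<integral>m\<in>A. indicat_real ?E m \<partial>?M) = P.prob (A \<inter> ?E)"
      using AM E
      by (simp add: set_lebesgue_integral_def flip: indicator_inter_arith)
    ultimately show "(\<integral>m\<in>A. indicat_real ?E m \<partial>?M) = (\<integral>m\<in>A. 1 / 2 ^ l \<partial>?M)"
      using AM by (simp add: set_lebesgue_integral_def)
  qed (use E in \<open>auto simp: P.emeasure_eq_measure\<close>)
qed

subsection \<open>Uncovered indices\<close>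

lemma uncovered_in_sets:
  assumes "finite V" "u \<in> V" "W \<subseteq> V"
  shows "{m \<in> space (skip_graph_space V). \<forall>v\<in>W. stake (Suc i) (m v) \<noteq> sibling_prefix i (m u)}
    \<in> sets (skip_graph_space V)"
proof (rule sets.sets_Collect_finite_All)
  fix v assume "v \<in> W"
  with assms have [measurable]: "(\<lambda>m. m v) \<in> skip_graph_space V \<rightarrow>\<^sub>M random_bits"
    "(\<lambda>m. m u) \<in> skip_graph_space V \<rightarrow>\<^sub>M random_bits"
    by (auto intro: measurable_vector)
  show "{m \<in> space (skip_graph_space V). stake (Suc i) (m v) \<noteq> sibling_prefix i (m u)}
      \<in> sets (skip_graph_space V)"
    by measurable
qed (use assms finite_subset in auto)

text \<open>Split by the first \<open>i + 1\<close> bits \<open>w\<close> of \<open>m u\<close>. For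
  fixed \<open>w\<close>, the vectors of \<open>W\<close> independently avoid one word of length
  \<open>i + 1\<close>. The \<open>2 ^ Suc i\<close> choices of \<open>w\<close> are equally likely
  and give the same product, so the sum over \<open>w\<close> returns that product.\<close>

lemma prob_uncovered:
  assumes "finite V" "u \<in> V" "W \<subseteq> V - {u}"
  shows "measure (skip_graph_space V)
      {m \<in> space (skip_graph_space V). \<forall>v\<in>W. stake (Suc i) (m v) \<noteq> sibling_prefix i (m u)}
    = (1 - 1 / 2 ^ Suc i) ^ card W"
proof -
  let ?M = "skip_graph_space V" and ?q = "1 - 1 / 2 ^ Suc i :: real"
  interpret P: prob_space ?M by (rule prob_space_skip_graph_space)
  interpret R: prob_space random_bits by (rule prob_space_random_bits)
  define X where "X = {w :: bool list. length w = Suc i}"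
  define sib where "sib w = butlast w @ [\<not> last w]" for w
  define A where "A w v = (if v = u then {x. stake (Suc i) x = w}
    else if v \<in> W then UNIV - {x. stake (Suc i) x = sib w} else UNIV)" for w v
  have X: "finite X" "card X = 2 ^ Suc i"
    unfolding X_def using finite_lists_length_eq[of "UNIV :: bool set" "Suc i"]
      card_lists_length_eq[of "UNIV :: bool set" "Suc i"] by auto
  \<comment> \<open>The forbidden word depends on \<open>m u\<close> only through its first
    \<open>i + 1\<close> bits, so fixing them as \<open>w\<close> turns the event into the box
    \<open>Pi\<^sub>E V (A w)\<close>.\<close>
  have sib: "sibling_prefix i x = sib (stake (Suc i) x)" for x
    by (simp add: sib_def sibling_prefix_def stake_Suc)
  have lsib: "length (sib w) = Suc i" if "w \<in> X" for w
    using that by (simp add: sib_def X_def)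
  have A: "A w v \<in> sets random_bits" for w v
    using prefix_in_sets_random_bits sets.compl_sets[OF prefix_in_sets_random_bits] sets.top[of random_bits]
    by (auto simp: A_def)
  have AM: "Pi\<^sub>E V (A w) \<in> sets ?M" for w
    unfolding skip_graph_space_def using A assms(1) by (intro sets_PiM_I_finite) auto
  have prob_A: "P.prob (Pi\<^sub>E V (A w)) = 1 / 2 ^ Suc i * ?q ^ card W" if "w \<in> X" for w
  proof -
    have "P.prob (Pi\<^sub>E V (A w)) = (\<Prod>v\<in>V. R.prob (A w v))"
      using assms(1) A by (rule measure_skip_graph_space_PiE)
    also have "\<dots> = (\<Prod>v\<in>insert u W. R.prob (A w v))"
      using assms R.prob_space by (intro prod.mono_neutral_right) (auto simp: A_def)
    also have "\<dots> = R.prob (A w u) * (\<Prod>v\<in>W. R.prob (A w v))"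
      using assms finite_subset[of W V] by (intro prod.insert) auto
    also have "R.prob (A w u) = 1 / 2 ^ Suc i"
      using that measure_random_bits_prefix[of w] by (simp add: A_def X_def)
    also have "(\<Prod>v\<in>W. R.prob (A w v)) = (\<Prod>v\<in>W. ?q)"
    proof (rule prod.cong)
      fix v assume v: "v \<in> W"
      then have "R.prob (A w v) = R.prob (space random_bits - {x. stake (Suc i) x = sib w})"
        using assms(3) by (auto simp: A_def)
      also have "\<dots> = ?q"
        using measure_random_bits_prefix[of "sib w"] lsib[OF that] prefix_in_sets_random_bits
        by (subst R.prob_compl) auto
      finally show "R.prob (A w v) = ?q" .
    qed simp
    finally show ?thesis by simp
  qed
  have "{m \<in> space ?M. \<forall>v\<in>W. stake (Suc i) (m v) \<noteq> sibling_prefix i (m u)} = (\<Union>w\<in>X. Pi\<^sub>E V (A w))"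
  proof (intro equalityI subsetI)
    fix m assume m: "m \<in> {m \<in> space ?M. \<forall>v\<in>W. stake (Suc i) (m v) \<noteq> sibling_prefix i (m u)}"
    then have "m \<in> Pi\<^sub>E V (A (stake (Suc i) (m u)))"
      by (auto simp: A_def sib skip_graph_space_def space_PiM PiE_def)
    then show "m \<in> (\<Union>w\<in>X. Pi\<^sub>E V (A w))"
      by (intro UN_I[of "stake (Suc i) (m u)"]) (simp_all add: X_def)
  next
    fix m assume "m \<in> (\<Union>w\<in>X. Pi\<^sub>E V (A w))"
    then obtain w where w: "w \<in> X" "m \<in> Pi\<^sub>E V (A w)" by auto
    then have "m u \<in> A w u" using assms by auto
    then have u: "stake (Suc i) (m u) = w" by (simp add: A_def)
    have "stake (Suc i) (m v) \<noteq> sib w" if "v \<in> W" for v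
    proof -
      have "m v \<in> A w v" using that w assms by auto
      moreover have "v \<noteq> u" using that assms by auto
      ultimately show ?thesis using that by (simp add: A_def)
    qed
    then show "m \<in> {m \<in> space ?M. \<forall>v\<in>W. stake (Suc i) (m v) \<noteq> sibling_prefix i (m u)}"
      using w u by (auto simp: sib skip_graph_space_def space_PiM PiE_def)
  qed
  \<comment> \<open>The coordinate \<open>u\<close> of a point in a box determines
    \<open>w\<close>.\<close>
  moreover have "disjoint_family_on (\<lambda>w. Pi\<^sub>E V (A w)) X"
    unfolding disjoint_family_on_def
  proof (intro ballI impI, rule ccontr)
    fix w w' assume "w \<noteq> w'" "Pi\<^sub>E V (A w) \<inter> Pi\<^sub>E V (A w') \<noteq> {}"
    then obtain m where "m \<in> Pi\<^sub>E V (A w)" "m \<in> Pi\<^sub>E V (A w')" by auto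
    then have "m u \<in> A w u" "m u \<in> A w' u" using assms by auto
    with \<open>w \<noteq> w'\<close> show False by (simp add: A_def)
  qed
  ultimately have "P.prob {m \<in> space ?M. \<forall>v\<in>W. stake (Suc i) (m v) \<noteq> sibling_prefix i (m u)}
      = (\<Sum>w\<in>X. P.prob (Pi\<^sub>E V (A w)))"
    using X AM by (simp only:) (rule P.finite_measure_finite_Union, auto)
  also have "\<dots> = ?q ^ card W"
    using X by (simp add: prob_A)
  finally show ?thesis .
qed

section \<open>The union bound over indices\<close>

lemma sum_exp_halving_le:
  fixes a :: real
  assumes "2 * exp (- (a / 2 ^ l)) \<le> 1"
  shows "(\<Sum>i<l. exp (- (a / 2 ^ Suc i))) \<le> 2 * exp (- (a / 2 ^ l))"
  using assms
proof (induction l)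
  case (Suc l)
  define q where "q = exp (- (a / 2 ^ Suc l))"
  have q: "exp (- (a / 2 ^ l)) = q * q"
    by (simp add: q_def flip: exp_add)
  have "2 * q \<le> 1" "0 \<le> q"
    using Suc.prems by (auto simp: q_def)
  \<comment> \<open>This serves twice: with \<open>q \<le> 1/2\<close> it gives the premise of the
    induction hypothesis, and it bounds the sum of the earlier terms, at most
    \<open>2 * (q * q)\<close>, by the last term \<open>q\<close>.\<close>
  then have "2 * (q * q) \<le> q"
    using mult_right_mono[of "2 * q" 1 q] by simp
  with Suc.IH \<open>2 * q \<le> 1\<close> have "(\<Sum>i<l. exp (- (a / 2 ^ Suc i))) \<le> q"
    by (simp add: q)
  then show ?case
    by (simp add: q_def)
qed simp

lemma prob_some_uncovered:
  assumes "finite V" "u \<in> V" "W \<subseteq> V - {u}"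
  shows "measure (skip_graph_space V)
      {m \<in> space (skip_graph_space V). \<exists>i<l. \<forall>v\<in>W. stake (Suc i) (m v) \<noteq> sibling_prefix i (m u)}
    \<le> 2 * exp (- (1 / 2 ^ l * real (card W)))" (is "measure ?M ?U \<le> ?b")
proof (cases "?b \<le> 1")
  case True
  interpret P: prob_space ?M by (rule prob_space_skip_graph_space)
  let ?U' = "\<lambda>i. {m \<in> space ?M. \<forall>v\<in>W. stake (Suc i) (m v) \<noteq> sibling_prefix i (m u)}"
  have U': "?U' i \<in> sets ?M" for i
    using assms by (intro uncovered_in_sets) auto
  have "?U = (\<Union>i<l. ?U' i)" by auto
  also have "P.prob \<dots> \<le> (\<Sum>i<l. P.prob (?U' i))"
    using U' by (intro P.finite_measure_subadditive_finite) auto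
  also have "\<dots> = (\<Sum>i<l. (1 - 1 / 2 ^ Suc i) ^ card W)"
    using prob_uncovered[OF assms] by simp
  also have "\<dots> \<le> (\<Sum>i<l. exp (- (real (card W) / 2 ^ Suc i)))"
  proof (rule sum_mono)
    fix i
    \<comment> \<open>This is \<open>1 - x \<le> exp (- x)\<close> raised to a power; the base is
      nonnegative because \<open>2 ^ Suc i\<close> is at least 1.\<close>
    have "(1 - 1 / 2 ^ Suc i) ^ card W \<le> exp (- (1 / 2 ^ Suc i :: real)) ^ card W"
      using exp_ge_add_one_self[of "- (1 / 2 ^ Suc i :: real)"] one_le_power[of "2::real" "Suc i"]
      by (intro power_mono) (auto simp del: power_Suc)
    also have "\<dots> = exp (- (real (card W) / 2 ^ Suc i))"
      by (simp flip: exp_of_nat_mult)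
    finally show "(1 - 1 / 2 ^ Suc i) ^ card W \<le> exp (- (real (card W) / 2 ^ Suc i))" .
  qed
  also have "\<dots> \<le> ?b"
    using True sum_exp_halving_le[of "real (card W)" l] by simp
  finally show ?thesis .
next
  case False
  interpret P: prob_space ?M by (rule prob_space_skip_graph_space)
  show ?thesis using False P.prob_le_1[of ?U] by linarith
qed

subsection \<open>Average congestion\<close>

text \<open>The covering event \<open>C\<close> depends only on vectors in \<open>[u, t]\<close>, so
  its indicator can be pulled out of the conditional expectation. On \<open>C\<close>, passing
  through \<open>u\<close> forces the common prefix event \<open>E\<close>, whose conditional
  probability is the constant \<open>1 / 2 ^ l\<close>.\<close>

lemma avg_congestion_le:
  fixes V :: "'a::linorder set"
  assumes "finite V" "s \<in> V" "u \<in> V" "s < u" "u < t"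
  shows "AE m in skip_graph_space V.
    (\<forall>i<l. \<exists>v\<in>{v \<in> V. u < v \<and> v \<le> t}. stake (Suc i) (m v) = sibling_prefix i (m u)) \<longrightarrow>
    avg_congestion V s t u m \<le> 1 / 2 ^ l"
proof -
  let ?M = "skip_graph_space V"
  define W where "W = {v \<in> V. u < v \<and> v \<le> t}"
  define I where "I = {x \<in> V. u \<le> x \<and> x \<le> t}"
  let ?F = "vectors_algebra V I"
  define C where "C = {m \<in> space ?M. \<forall>i<l. \<exists>v\<in>W. stake (Suc i) (m v) = sibling_prefix i (m u)}"
  define P where "P = {m \<in> space ?M. passes_through V m s t u}"
  define E where "E = {m \<in> space ?M. stake l (m s) = stake l (m u)}"
  have I: "I \<subseteq> V" "s \<in> V - I" "u \<in> I" "W \<subseteq> I" "finite W"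
    using assms by (auto simp: I_def W_def)
  interpret prob_space ?M by (rule prob_space_skip_graph_space)
  interpret finite_measure_subalgebra ?M ?F
    using subalgebra_vectors_algebra[OF I(1)] by unfold_locales
  have CF: "C \<in> sets ?F"
  proof -
    have *: "{m \<in> space ?F. stake (Suc i) (m v) = sibling_prefix i (m u)} \<in> sets ?F" if "v \<in> W" for i v
    proof -
      have [measurable]: "(\<lambda>m. m v) \<in> ?F \<rightarrow>\<^sub>M random_bits" "(\<lambda>m. m u) \<in> ?F \<rightarrow>\<^sub>M random_bits"
        using I that by (auto intro: measurable_vectors_algebra)
      show ?thesis by measurable
    qed
    have "{m \<in> space ?F. \<forall>i\<in>{..<l}. \<exists>v\<in>W. stake (Suc i) (m v) = sibling_prefix i (m u)} \<in> sets ?F"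
      using I * by (intro sets.sets_Collect_finite_All sets.sets_Collect_finite_Ex) auto
    also have "{m \<in> space ?F. \<forall>i\<in>{..<l}. \<exists>v\<in>W. stake (Suc i) (m v) = sibling_prefix i (m u)} = C"
      unfolding C_def using subalg by (auto simp only: subalgebra_def lessThan_iff)
    finally show ?thesis .
  qed
  have "AE m in ?M. m \<in> C \<longrightarrow> real_cond_exp ?M ?F (indicator P) m \<le> 1 / 2 ^ l"
  proof (cases "P \<in> sets ?M")
    case True
    have EM: "E \<in> sets ?M"
      unfolding E_def using assms by (intro common_prefix_in_sets)
    have CM: "C \<in> sets ?M"
      using CF subalg by (auto simp: subalgebra_def)
    have "C \<inter> P \<subseteq> E"
      using passes_through_common_prefix[OF assms(1)] unfolding C_def P_def E_def W_def by blast
    then have le: "indicator C m * indicator P m \<le> (indicator E m :: real)" for m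
      by (auto split: split_indicator)
    have int: "integrable ?M (indicat_real X)" if "X \<in> sets ?M" for X
      using that by (auto simp: emeasure_eq_measure)
    have CP: "integrable ?M (\<lambda>m. indicator C m * indicator P m :: real)"
      using integrable_mult_indicator[OF CM int[OF True]] by simp
    have "AE m in ?M. real_cond_exp ?M ?F (\<lambda>m. indicator C m * indicator P m) m
        \<le> real_cond_exp ?M ?F (indicator E) m"
      using le CP int[OF EM] by (intro real_cond_exp_mono) auto
    moreover have "AE m in ?M. real_cond_exp ?M ?F (\<lambda>m. indicator C m * indicator P m) m
        = indicator C m * real_cond_exp ?M ?F (indicator P) m"
      using CP CF True by (intro real_cond_exp_mult) auto
    moreover have "AE m in ?M. real_cond_exp ?M ?F (indicator E) m = 1 / 2 ^ l"
      unfolding E_def using assms(1) I(1-3) by (rule cond_exp_common_prefix)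
    ultimately show ?thesis by eventually_elim auto
  next
    \<comment> \<open>This case does not occur, but excluding it is not needed: the conditional expectation of a
      non-measurable function is \<open>0\<close> by convention.\<close>
    case False
    \<comment> \<open>The real conditional expectation is built from \<open>ennreal\<close>-valued
      positive and negative parts, so the failure of measurability is carried over to the
      \<open>ennreal\<close>-valued indicator.\<close>
    have P_eq: "P = indicator P -` {1 :: ennreal} \<inter> space ?M"
      by (auto simp: P_def indicator_def)
    have "(indicator P :: _ \<Rightarrow> ennreal) \<notin> borel_measurable ?M"
      using False P_eq measurable_sets[of "indicator P :: _ \<Rightarrow> ennreal" ?M borel "{1}"] by auto
    moreover have "(\<lambda>m. ennreal (indicator P m)) = indicator P" "(\<lambda>m. ennreal (- indicator P m)) = (\<lambda>_. 0)"
      by (auto simp: indicator_def fun_eq_iff ennreal_neg)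
    moreover have "enn2real (nn_cond_exp ?M ?F f m) \<ge> 0" for f m
      by simp
    ultimately have "real_cond_exp ?M ?F (indicator P) m \<le> 0" for m
      by (simp add: real_cond_exp_def nn_cond_exp_def)
    then have "real_cond_exp ?M ?F (indicator P) m \<le> 1 / 2 ^ l" for m
      by (rule order_trans) simp
    then show ?thesis by simp
  qed
  with AE_space show ?thesis
    by eventually_elim (auto simp: C_def W_def P_def I_def avg_congestion_def)
qed

theorem theorem6:
  fixes V :: "'a::linorder set" and s t u :: 'a and d l :: nat
  assumes "finite V" and "s \<in> V" and "t \<in> V" and "u \<in> V"
    and "s < u" and "u < t"
    and "d = card {v \<in> V. u < v \<and> v \<le> t}"
  shows "measure (skip_graph_space V)
           {m \<in> space (skip_graph_space V). avg_congestion V s t u m > 1 / 2 ^ l}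
         \<le> 2 * exp (- (1 / 2 ^ l * real d))"
proof -
  let ?M = "skip_graph_space V"
  define W where "W = {v \<in> V. u < v \<and> v \<le> t}"
  let ?L = "{m \<in> space ?M. avg_congestion V s t u m > 1 / 2 ^ l}"
  let ?U = "{m \<in> space ?M. \<exists>i<l. \<forall>v\<in>W. stake (Suc i) (m v) \<noteq> sibling_prefix i (m u)}"
  interpret prob_space ?M by (rule prob_space_skip_graph_space)
  have W: "finite W" "W \<subseteq> V - {u}" "W \<subseteq> V"
    using assms by (auto simp: W_def)
  have "{m \<in> space ?M. \<forall>v\<in>W. stake (Suc i) (m v) \<noteq> sibling_prefix i (m u)} \<in> sets ?M" for i
    using assms W by (intro uncovered_in_sets) auto
  then have "(\<Union>i<l. {m \<in> space ?M. \<forall>v\<in>W. stake (Suc i) (m v) \<noteq> sibling_prefix i (m u)}) \<in> sets ?M"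
    by auto
  also have "(\<Union>i<l. {m \<in> space ?M. \<forall>v\<in>W. stake (Suc i) (m v) \<noteq> sibling_prefix i (m u)}) = ?U"
    by auto
  finally have U: "?U \<in> sets ?M" .
  \<comment> \<open>Contrapositive of the congestion bound. It holds almost everywhere, as the
    conditional expectation is determined only up to null sets; this suffices to compare the
    probabilities of \<open>?L\<close> and \<open>?U\<close>.\<close>
  have "AE m in ?M. m \<in> ?L \<longrightarrow> m \<in> ?U"
    using avg_congestion_le[OF assms(1,2,4,5,6), of l]
  proof eventually_elim
    case (elim m)
    show "m \<in> ?L \<longrightarrow> m \<in> ?U"
    proof
      assume m: "m \<in> ?L"
      then have "\<not> (\<forall>i<l. \<exists>v\<in>W. stake (Suc i) (m v) = sibling_prefix i (m u))"
        using elim unfolding W_def by auto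
      with m show "m \<in> ?U" by blast
    qed
  qed
  then have "measure ?M ?L \<le> measure ?M ?U"
    using U by (rule finite_measure_mono_AE)
  also have "\<dots> \<le> 2 * exp (- (1 / 2 ^ l * real (card W)))"
    using assms W by (intro prob_some_uncovered) auto
  finally show ?thesis using assms(7) by (simp add: W_def)
qed

end
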